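(* Identify each of the following sequent calculus and cirquent calculus systems with the set of formulas it proves. Then (1) Affine logic $= \mathbf{CL5}^* \subseteq \mathbf{CL5}$, and $\mathbf{CL5}\neq$ Affine logic; (2) Classical logic $= \mathbf{CCC}^*\subseteq \mathbf{CCC} =$ Classical logic.
   Context: Formulas: built from infinitely many propositional atoms (no constants) using $\neg,\wedge,\vee$ (binary), with $\neg$ applied only to atoms; $\neg\neg F$, $\neg(F\wedge G)$, $\neg(F\vee G)$, $F\to G$ abbreviate $F$, $\neg F\vee\neg G$, $\neg F\wedge\neg G$, $\neg F\vee G$. Sequent calculus: a sequent is a nonempty finite sequence of formulas. Rules ($\Gamma,\Delta$ possibly empty sequences): Axiom $\neg F,F$; Exchange: $\Gamma,F,G,\Delta \Rightarrow \Gamma,G,F,\Delta$; Weakening: $\Gamma,\Delta\Rightarrow\Gamma,F,\Delta$; Contraction: $\Gamma,F,F,\Delta\Rightarrow\Gamma,F,\Delta$; $\vee$-introduction: $\Gamma,F,G,\Delta\Rightarrow\Gamma,F\vee G,\Delta$; $\wedge$-introduction: from $\Gamma,F$ and $G,\Delta$ infer $\Gamma,F\wedge G,\Delta$. Classical logic is the system with all six rules; Affine logic is all rules except Contraction. Provability via finite proof trees; a formula is provable iff the one-element sequent is. Cirquents: a $k$-ary pool is a sequence $\langle F_1,\dots,F_k\rangle$ of formulas (entries called oformulas; repetitions allowed). A $k$-ary structure is a finite sequence $\langle\Gamma_1,\dots,\Gamma_m\rangle$ ($m\ge0$, repetitions allowed) of subsets of $\{1,\dots,k\}$ (entries called ogroups);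 ogroup $\Gamma$ contains the oformulas $F_i$, $i\in\Gamma$. A $k$-ary cirquent is a pair (structure, pool) of a $k$-ary structure and a $k$-ary pool. A formula $F$ is identified with the cirquent $(\langle\{1\}\rangle,\langle F\rangle)$. Cirquent calculus rules: (A) Axioms: the empty cirquent $(\langle\rangle,\langle\rangle)$, and $(\langle\{1,2\}\rangle,\langle\neg F,F\rangle)$ for every formula $F$. (M) Mix: from $(\langle\Gamma_1,\dots,\Gamma_m\rangle,\langle F_1,\dots,F_k\rangle)$ and $(\langle\Delta_1,\dots,\Delta_n\rangle,\langle G_1,\dots,G_l\rangle)$ infer $(\langle\Gamma_1,\dots,\Gamma_m,\Delta_1+k,\dots,\Delta_n+k\rangle,\langle F_1,\dots,F_k,G_1,\dots,G_l\rangle)$, where $\Delta+k=\{j+k:j\in\Delta\}$. (E) Exchange: either swap two adjacent oformulas of the pool, redirecting indices so every ogroup contains the same oformulas as before; or swap two adjacent ogroups of the structure. (W) Weakening: either add to one ogroup the index of an existing oformula; or insert a new formula anywhere in the pool, renumbering so every ogroup contains the same oformulas as before. (D) Duplication: replace an ogroup $\Gamma$ by two adjacent ogroups $\Gamma,\Gamma$ (downward), or replace two adjacent ogroups equal as sets by one copy (upward). (C) Contraction: replace two adjacent oformulas that are the same formula $F$ by a single oformula $F$, each ogroup that contained either of them now containing the new one. ($\vee$) $\vee$-introduction: replace two adjacent oformulas $F,G$ by a single oformula $F\vee G$; an ogroup contains the new oformula iff it contained $F$ or $G$. ($\wedge$) $\wedge$-introduction: applicable when for adjacent oformulas $F,G$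 no ogroup contains both, every ogroup containing $F$ is immediately followed in the structure by an ogroup containing $G$, and every ogroup containing $G$ is immediately preceded by an ogroup containing $F$; the conclusion replaces each such pair of adjacent ogroups by their union and then replaces $F,G$ by a single oformula $F\wedge G$ (as in $\vee$-introduction). A proof of a cirquent in a cirquent calculus system (a set of these rules) is a finite tree of cirquents with that cirquent at the root, each node following from its children by a rule of the system. $\mathbf{CCC}$ is the system with all eight rules (A, M, E, W, D, C, $\vee$, $\wedge$); $\mathbf{CL5}$ is all rules except Contraction. A cirquent is primitive iff its ogroups are pairwise disjoint. For a system $S$, $S^*$ is the system whose proofs are the proofs of $S$ in which every cirquent is primitive. *)

theory Defs
  imports Main "HOL-Library.Disjoint_Sets" "HOL-Combinatorics.Transposition"
begin

datatype 'a formula =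
    Atom 'a
  | NegAtom 'a
  | And "'a formula" "'a formula"
  | Or "'a formula" "'a formula"

primrec neg :: "'a formula \<Rightarrow> 'a formula" where
  "neg (Atom p) = NegAtom p"
| "neg (NegAtom p) = Atom p"
| "neg (And F G) = Or (neg F) (neg G)"
| "neg (Or F G) = And (neg F) (neg G)"

datatype (nodes: 'c) ptree = PNode (root: 'c) (children: "'c ptree list")

fun follows_rules :: "('c list \<Rightarrow> 'c \<Rightarrow> bool) \<Rightarrow> 'c ptree \<Rightarrow> bool" where
  "follows_rules R (PNode c ts) \<longleftrightarrow> R (map root ts) c \<and> (\<forall>t\<in>set ts. follows_rules R t)"


type_synonym 'a sequent = "'a formula list"

datatype seq_rule = SAxiom | SExchange | SWeakening | SContraction | SOr | SAnd

inductive seq_inference :: "seq_rule \<Rightarrow> 'a sequent list \<Rightarrow> 'a sequent \<Rightarrow> bool" where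
  "seq_inference SAxiom [] [neg F, F]"
| "seq_inference SExchange [\<Gamma> @ [F, G] @ \<Delta>] (\<Gamma> @ [G, F] @ \<Delta>)"
| "seq_inference SWeakening [\<Gamma> @ \<Delta>] (\<Gamma> @ [F] @ \<Delta>)"
| "seq_inference SContraction [\<Gamma> @ [F, F] @ \<Delta>] (\<Gamma> @ [F] @ \<Delta>)"
| "seq_inference SOr [\<Gamma> @ [F, G] @ \<Delta>] (\<Gamma> @ [Or F G] @ \<Delta>)"
| "seq_inference SAnd [\<Gamma> @ [F], [G] @ \<Delta>] (\<Gamma> @ [And F G] @ \<Delta>)"

definition seq_proofs :: "seq_rule set \<Rightarrow> 'a sequent ptree set" where
  "seq_proofs S = {t. (\<forall>\<Gamma>\<in>nodes t. \<Gamma> \<noteq> []) \<and>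
     follows_rules (\<lambda>ps c. \<exists>r\<in>S. seq_inference r ps c) t}"

definition seq_theorems :: "seq_rule set \<Rightarrow> 'a formula set" where
  "seq_theorems S = {F. \<exists>t\<in>seq_proofs S. root t = [F]}"

definition Classical_logic :: "seq_rule set" where
  "Classical_logic = UNIV"

definition Affine_logic :: "seq_rule set" where
  "Affine_logic = UNIV - {SContraction}"


text \<open>A cirquent is a pair (structure, pool). Oformulas are numbered from \<open>0\<close>, following
  list indexing, so a \<open>k\<close>-ary cirquent has ogroups that are subsets of \<open>{..<k}\<close>.\<close>

type_synonym 'a cirquent = "nat set list \<times> 'a formula list"

definition is_cirquent :: "'a cirquent \<Rightarrow> bool" where
  "is_cirquent C \<longleftrightarrow> (\<forall>\<Gamma>\<in>set (fst C). \<Gamma> \<subseteq> {..<length (snd C)})"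

definition formula_cirquent :: "'a formula \<Rightarrow> 'a cirquent" where
  "formula_cirquent F = ([{0}], [F])"

text \<open>Renumbering of the oformulas when a new one is inserted at position \<open>n\<close>.\<close>

definition open_at :: "nat \<Rightarrow> nat \<Rightarrow> nat" where
  "open_at n i = (if i < n then i else Suc i)"

text \<open>Renumbering of the oformulas when those at positions \<open>n\<close> and \<open>n + 1\<close> become a
  single one at position \<open>n\<close>.\<close>

definition merge_at :: "nat \<Rightarrow> nat \<Rightarrow> nat" where
  "merge_at n i = (if i \<le> n then i else i - 1)"

definition and_applicable :: "nat \<Rightarrow> nat set list \<Rightarrow> bool" where
  "and_applicable n st \<longleftrightarrow>
     (\<forall>i<length st. \<not> (n \<in> st ! i \<and> n + 1 \<in> st ! i)) \<and>
     (\<forall>i<length st. n \<in> st ! i \<longrightarrow> i + 1 < length st \<and> n + 1 \<in> st ! (i + 1)) \<and>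
     (\<forall>i<length st. n + 1 \<in> st ! i \<longrightarrow> i > 0 \<and> n \<in> st ! (i - 1))"

text \<open>Under \<^const>\<open>and_applicable\<close> the pairs to be united do not overlap, so the left-to-right
  traversal unites all of them.\<close>

fun unite_pairs :: "nat \<Rightarrow> nat set list \<Rightarrow> nat set list" where
  "unite_pairs n (\<Gamma> # \<Delta> # st) =
     (if n \<in> \<Gamma> \<and> n + 1 \<in> \<Delta> then (\<Gamma> \<union> \<Delta>) # unite_pairs n st
      else \<Gamma> # unite_pairs n (\<Delta> # st))"
| "unite_pairs n st = st"

datatype cirq_rule =
  CAxiom | CMix | CExchange | CWeakening | CDuplication | CContraction | COr | CAnd

inductive cirq_inference :: "cirq_rule \<Rightarrow> 'a cirquent list \<Rightarrow> 'a cirquent \<Rightarrow> bool" where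
  axiom_empty:
    "cirq_inference CAxiom [] ([], [])"
| axiom_id:
    "cirq_inference CAxiom [] ([{0, 1}], [neg F, F])"
| mix:
    "cirq_inference CMix [(st, Fs), (st', Gs)]
       (st @ map (image (\<lambda>j. j + length Fs)) st', Fs @ Gs)"
| exchange_oformulas:
    "cirq_inference CExchange [(st, Fs @ [F, G] @ Gs)]
       (map (image (Transposition.transpose (length Fs) (length Fs + 1))) st, Fs @ [G, F] @ Gs)"
| exchange_ogroups:
    "cirq_inference CExchange [(st @ [\<Gamma>, \<Delta>] @ st', Fs)] (st @ [\<Delta>, \<Gamma>] @ st', Fs)"
| weakening_ogroup:
    "i < length Fs \<Longrightarrow>
     cirq_inference CWeakening [(st @ [\<Gamma>] @ st', Fs)] (st @ [insert i \<Gamma>] @ st', Fs)"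
| weakening_pool:
    "cirq_inference CWeakening [(st, Fs @ Gs)]
       (map (image (open_at (length Fs))) st, Fs @ [F] @ Gs)"
| duplication_down:
    "cirq_inference CDuplication [(st @ [\<Gamma>] @ st', Fs)] (st @ [\<Gamma>, \<Gamma>] @ st', Fs)"
| duplication_up:
    "cirq_inference CDuplication [(st @ [\<Gamma>, \<Gamma>] @ st', Fs)] (st @ [\<Gamma>] @ st', Fs)"
| contraction:
    "cirq_inference CContraction [(st, Fs @ [F, F] @ Gs)]
       (map (image (merge_at (length Fs))) st, Fs @ [F] @ Gs)"
| or_intro:
    "cirq_inference COr [(st, Fs @ [F, G] @ Gs)]
       (map (image (merge_at (length Fs))) st, Fs @ [Or F G] @ Gs)"
| and_intro:
    "and_applicable (length Fs) st \<Longrightarrow>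
     cirq_inference CAnd [(st, Fs @ [F, G] @ Gs)]
       (map (image (merge_at (length Fs))) (unite_pairs (length Fs) st), Fs @ [And F G] @ Gs)"

definition cirq_proofs :: "cirq_rule set \<Rightarrow> 'a cirquent ptree set" where
  "cirq_proofs S = {t. (\<forall>C\<in>nodes t. is_cirquent C) \<and>
     follows_rules (\<lambda>ps c. \<exists>r\<in>S. cirq_inference r ps c) t}"

text \<open>Ogroups are compared by position in the structure: a nonempty ogroup that occurs twice
  makes the cirquent non-primitive.\<close>

definition primitive :: "'a cirquent \<Rightarrow> bool" where
  "primitive C \<longleftrightarrow> disjoint_family_on (\<lambda>i. fst C ! i) {..<length (fst C)}"

definition star_proofs :: "cirq_rule set \<Rightarrow> 'a cirquent ptree set" where
  "star_proofs S = {t \<in> cirq_proofs S. \<forall>C\<in>nodes t. primitive C}"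

definition cirq_theorems :: "cirq_rule set \<Rightarrow> 'a formula set" where
  "cirq_theorems S = {F. \<exists>t\<in>cirq_proofs S. root t = formula_cirquent F}"

definition star_theorems :: "cirq_rule set \<Rightarrow> 'a formula set" where
  "star_theorems S = {F. \<exists>t\<in>star_proofs S. root t = formula_cirquent F}"

definition CCC :: "cirq_rule set" where
  "CCC = UNIV"

definition CL5 :: "cirq_rule set" where
  "CL5 = UNIV - {CContraction}"

end

theory Submission
  imports Defs "HOL-Library.Multiset"
begin

text \<open>
  A sequent is a cirquent with a single ogroup, and mix followed by \<open>\<and>\<close>-introduction
  simulates the sequent rule for \<open>\<and>\<close>. Conversely, the sequent formed by the oformulas of any ogroup
  of a provable cirquent is provable. The only delicate rule is \<open>\<and>\<close>-introduction, which replaces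
  two ogroups by their union: oformulas shared by the two have to be contracted, and primitiveness
  says that there are none.

  CL5 proves the instance \<open>(A \<and> A) \<or> (C \<and> C)\<close> of Blass's principle, where \<open>A = \<not>p \<or> \<not>p\<close> and
  \<open>C = p \<or> p\<close>. Affine logic does not, because splitting either conjunction of the sequent
  \<open>A \<and> A, C \<and> C\<close> leaves \<open>A\<close> or \<open>C\<close> alone in one of the premises.
\<close>

section \<open>Derivability\<close>

text \<open>Replaces proof trees by an inductive predicate so that rule induction applies.
  \<open>P\<close> is the condition that every node must meet: nonemptiness for sequents,
  \<open>is_cirquent\<close> for cirquents, and primitiveness in addition for the starred
  systems.\<close>

inductive derivable :: "('c list \<Rightarrow> 'c \<Rightarrow> bool) \<Rightarrow> ('c \<Rightarrow> bool) \<Rightarrow> 'c \<Rightarrow> bool"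
  for R P where
  step: "R ps c \<Longrightarrow> P c \<Longrightarrow> (\<And>p. p \<in> set ps \<Longrightarrow> derivable R P p) \<Longrightarrow> derivable R P c"

lemma derivable_of_tree:
  "follows_rules R t \<Longrightarrow> \<forall>x\<in>nodes t. P x \<Longrightarrow> derivable R P (root t)"
proof (induction t)
  case (PNode c ts)
  show ?case
  proof (rule derivable.step[of R "map root ts"])
    fix p assume "p \<in> set (map root ts)"
    then obtain t where "t \<in> set ts" "p = root t" by auto
    then show "derivable R P p" using PNode by auto
  qed (use PNode in auto)
qed

lemma tree_of_derivable:
  "derivable R P c \<Longrightarrow> \<exists>t. root t = c \<and> follows_rules R t \<and> (\<forall>x\<in>nodes t. P x)"
proof (induction rule: derivable.induct)
  case (step ps c)
  \<comment> \<open>One tree is chosen per premise; premises that occur twice in \<open>ps\<close>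
    receive the same subtree.\<close>
  then obtain f where f: "\<And>p. p \<in> set ps \<Longrightarrow>
      root (f p) = p \<and> follows_rules R (f p) \<and> (\<forall>x\<in>nodes (f p). P x)"
    by metis
  have "map root (map f ps) = ps"
    using f by (simp add: map_idI)
  then show ?case
    using f step by (intro exI[of _ "PNode c (map f ps)"]) auto
qed

lemma tree_iff_derivable:
  "(\<exists>t. root t = c \<and> follows_rules R t \<and> (\<forall>x\<in>nodes t. P x)) \<longleftrightarrow> derivable R P c"
  using derivable_of_tree tree_of_derivable by metis

abbreviation seq_step :: "seq_rule set \<Rightarrow> 'a sequent list \<Rightarrow> 'a sequent \<Rightarrow> bool" where
  "seq_step S \<equiv> \<lambda>ps c. \<exists>r\<in>S. seq_inference r ps c"

abbreviation cirq_step :: "cirq_rule set \<Rightarrow> 'a cirquent list \<Rightarrow> 'a cirquent \<Rightarrow> bool" where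
  "cirq_step S \<equiv> \<lambda>ps c. \<exists>r\<in>S. cirq_inference r ps c"

abbreviation seq_derivable :: "seq_rule set \<Rightarrow> 'a sequent \<Rightarrow> bool" where
  "seq_derivable S \<equiv> derivable (seq_step S) (\<lambda>\<Gamma>. \<Gamma> \<noteq> [])"

abbreviation cirq_derivable :: "cirq_rule set \<Rightarrow> 'a cirquent \<Rightarrow> bool" where
  "cirq_derivable S \<equiv> derivable (cirq_step S) is_cirquent"

abbreviation star_derivable :: "cirq_rule set \<Rightarrow> 'a cirquent \<Rightarrow> bool" where
  "star_derivable S \<equiv> derivable (cirq_step S) (\<lambda>C. is_cirquent C \<and> primitive C)"

lemma seq_theorems_iff: "F \<in> seq_theorems S \<longleftrightarrow> seq_derivable S [F]"
  by (auto simp: seq_theorems_def seq_proofs_def Bex_def simp flip: tree_iff_derivable)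

lemma cirq_theorems_iff: "F \<in> cirq_theorems S \<longleftrightarrow> cirq_derivable S (formula_cirquent F)"
  by (auto simp: cirq_theorems_def cirq_proofs_def Bex_def simp flip: tree_iff_derivable)

lemma star_theorems_iff: "F \<in> star_theorems S \<longleftrightarrow> star_derivable S (formula_cirquent F)"
  by (auto simp: star_theorems_def star_proofs_def cirq_proofs_def Bex_def
      simp flip: tree_iff_derivable)

lemma star_theorems_subset_cirq_theorems: "star_theorems S \<subseteq> cirq_theorems S"
  unfolding star_theorems_def star_proofs_def cirq_theorems_def by blast

lemma derivable_step0: "R [] c \<Longrightarrow> P c \<Longrightarrow> derivable R P c"
  by (rule derivable.step[of R "[]"]) auto

lemma derivable_step1: "derivable R P p \<Longrightarrow> R [p] c \<Longrightarrow> P c \<Longrightarrow> derivable R P c"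
  by (rule derivable.step[of R "[p]"]) auto

lemma derivable_step2:
  "derivable R P p \<Longrightarrow> derivable R P q \<Longrightarrow> R [p, q] c \<Longrightarrow> P c \<Longrightarrow> derivable R P c"
  by (rule derivable.step[of R "[p, q]"]) auto

lemma derivable_invariant: "derivable R P c \<Longrightarrow> P c"
  by (erule derivable.cases) simp

lemma seq_derivable1:
  "seq_inference r [\<Gamma>] \<Delta> \<Longrightarrow> seq_derivable S \<Gamma> \<Longrightarrow> r \<in> S \<Longrightarrow> \<Delta> \<noteq> [] \<Longrightarrow> seq_derivable S \<Delta>"
  by (rule derivable_step1) auto

lemma seq_derivable2:
  "seq_inference r [\<Gamma>, \<Gamma>'] \<Delta> \<Longrightarrow> seq_derivable S \<Gamma> \<Longrightarrow> seq_derivable S \<Gamma>' \<Longrightarrow> r \<in> S \<Longrightarrow>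
    \<Delta> \<noteq> [] \<Longrightarrow> seq_derivable S \<Delta>"
  by (rule derivable_step2[of _ _ \<Gamma> \<Gamma>']) auto

section \<open>Sequents as multisets\<close>

text \<open>Repeated adjacent swaps carry \<open>y\<close> to the left. The induction runs from the
  right end of \<open>as\<close>, because \<open>y\<close> passes the last entry first.\<close>

lemma seq_derivable_move:
  assumes "SExchange \<in> S"
  shows "seq_derivable S (zs @ as @ y # ws) \<Longrightarrow> seq_derivable S (zs @ y # as @ ws)"
proof (induction as arbitrary: ws rule: rev_induct)
  case Nil
  then show ?case by simp
next
  case (snoc a as)
  have "seq_derivable S ((zs @ as) @ [y, a] @ ws)"
    by (rule seq_derivable1[OF seq_inference.intros(2)]) (use snoc.prems assms in auto)
  then show ?case using snoc.IH[of "a # ws"] by simp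
qed

text \<open>The head of \<open>ys\<close> is moved to the front of \<open>xs\<close> and absorbed
  into the fixed prefix, which is why \<open>zs\<close> has to vary in the induction.\<close>

lemma seq_derivable_perm:
  assumes "SExchange \<in> S" "seq_derivable S (zs @ xs)" "mset xs = mset ys"
  shows "seq_derivable S (zs @ ys)"
  using assms(2,3)
proof (induction ys arbitrary: zs xs)
  case Nil
  then show ?case by simp
next
  case (Cons y ys)
  have "y \<in> set xs" using Cons.prems(2) by (metis list.set_intros(1) set_mset_mset)
  then obtain as bs where xs: "xs = as @ y # bs" by (meson split_list)
  have "seq_derivable S ((zs @ [y]) @ as @ bs)"
    using seq_derivable_move[OF assms(1), of zs as y bs] Cons.prems xs by simp
  from Cons.IH[OF this] show ?case using Cons.prems(2) xs by simp
qed

text \<open>One ordering is demanded here; in the presence of exchange, any ordering is then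
  derivable. Contexts can thus be treated as multisets.\<close>

definition mset_derivable :: "seq_rule set \<Rightarrow> 'a formula multiset \<Rightarrow> bool" where
  "mset_derivable S M \<longleftrightarrow> (\<exists>xs. mset xs = M \<and> seq_derivable S xs)"

lemma mset_derivableI: "seq_derivable S xs \<Longrightarrow> mset xs = M \<Longrightarrow> mset_derivable S M"
  unfolding mset_derivable_def by blast

lemma mset_derivable_mset:
  "SExchange \<in> S \<Longrightarrow> mset_derivable S (mset xs) \<longleftrightarrow> seq_derivable S xs"
  using seq_derivable_perm[of S "[]"] by (auto simp: mset_derivable_def)

text \<open>Exchange lets the active formulas stand at either end of the context. Both forms are
  needed: \<open>SAnd\<close> wants \<open>F\<close> last in its left premise and \<open>G\<close>
  first in its right one.\<close>

lemma mset_derivable_add_mset: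
  assumes "SExchange \<in> S" "mset_derivable S (mset xs + M)"
  obtains ys where "mset ys = M" "seq_derivable S (xs @ ys)" "seq_derivable S (ys @ xs)"
proof -
  obtain ys where ys: "mset ys = M" by (meson ex_mset)
  then have eq: "mset xs + M = mset (xs @ ys)" "mset xs + M = mset (ys @ xs)" by simp_all
  have "seq_derivable S (xs @ ys)" "seq_derivable S (ys @ xs)"
    using assms(2) unfolding mset_derivable_mset[OF assms(1), symmetric] eq[symmetric] by -
  with ys show ?thesis by (rule that)
qed

text \<open>Serves affine and classical logic at once; lemmas that contract assume
  \<open>SContraction \<in> S\<close> separately.\<close>

locale affine_rules =
  fixes S :: "seq_rule set"
  assumes affine: "UNIV - {SContraction} \<subseteq> S"
begin

lemma rules: "SAxiom \<in> S" "SExchange \<in> S" "SWeakening \<in> S" "SOr \<in> S" "SAnd \<in> S"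
  using affine by auto

lemma mset_derivable_axiom: "mset_derivable S {#neg F, F#}"
  unfolding mset_derivable_def
  by (rule exI[of _ "[neg F, F]"])
    (use rules in \<open>auto intro!: derivable_step0 intro: seq_inference.intros(1)\<close>)

lemma mset_derivable_weakening:
  assumes "mset_derivable S M" shows "mset_derivable S (add_mset F M)"
proof -
  obtain xs where xs: "mset xs = M" "seq_derivable S xs"
    using assms by (auto simp: mset_derivable_def)
  have "seq_derivable S ([] @ [F] @ xs)"
    by (rule seq_derivable1[OF seq_inference.intros(3)]) (use xs rules in auto)
  then show ?thesis by (rule mset_derivableI) (use xs in simp)
qed

lemma mset_derivable_contraction:
  assumes "SContraction \<in> S" "mset_derivable S (add_mset F (add_mset F M))"
  shows "mset_derivable S (add_mset F M)"
proof -
  obtain xs where xs: "mset xs = M" "seq_derivable S ([F, F] @ xs)"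
    using mset_derivable_add_mset[of S "[F, F]" M] assms rules by auto
  have "seq_derivable S ([] @ [F] @ xs)"
    by (rule seq_derivable1[OF seq_inference.intros(4)]) (use xs assms in auto)
  then show ?thesis by (rule mset_derivableI) (use xs in simp)
qed

lemma mset_derivable_or:
  assumes "mset_derivable S (add_mset F (add_mset G M))"
  shows "mset_derivable S (add_mset (Or F G) M)"
proof -
  obtain xs where xs: "mset xs = M" "seq_derivable S ([F, G] @ xs)"
    using mset_derivable_add_mset[of S "[F, G]" M] assms rules by (auto simp: add_mset_commute)
  have "seq_derivable S ([] @ [Or F G] @ xs)"
    by (rule seq_derivable1[OF seq_inference.intros(5)]) (use xs rules in auto)
  then show ?thesis by (rule mset_derivableI) (use xs in simp)
qed

lemma mset_derivable_and:
  assumes "mset_derivable S (add_mset F M)" "mset_derivable S (add_mset G N)"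
  shows "mset_derivable S (add_mset (And F G) (M + N))"
proof -
  obtain xs where xs: "mset xs = M" "seq_derivable S (xs @ [F])"
    using mset_derivable_add_mset[of S "[F]" M] assms rules by auto
  obtain ys where ys: "mset ys = N" "seq_derivable S ([G] @ ys)"
    using mset_derivable_add_mset[of S "[G]" N] assms rules by auto
  have "seq_derivable S (xs @ [And F G] @ ys)"
    by (rule seq_derivable2[OF seq_inference.intros(6) xs(2) ys(2)]) (use rules in auto)
  then show ?thesis by (rule mset_derivableI) (use xs ys in simp)
qed

text \<open>Each formula of \<open>N\<close> also occurs in \<open>M\<close>, so one contraction
  against that occurrence removes it; induction on \<open>N\<close> removes them all.\<close>

lemma mset_derivable_contractions:
  assumes "SContraction \<in> S" "mset_derivable S (M + N)" "N \<subseteq># M"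
  shows "mset_derivable S M"
  using assms(2,3)
proof (induction N)
  case empty
  then show ?case by simp
next
  case (add F N)
  have "F \<in># M" using add.prems(2) by (meson mset_subset_eqD union_single_eq_member)
  then obtain M' where M: "M = add_mset F M'" by (meson multi_member_split)
  have "mset_derivable S (add_mset F (M' + N))"
    using mset_derivable_contraction[OF assms(1)] add.prems M by simp
  then show ?case
    using add.IH add.prems(2) M subset_mset.order_trans[of N M' M] by simp
qed

end

section \<open>From cirquents to sequents\<close>

text \<open>A multiset, since distinct oformulas of an ogroup may be equal formulas and affine logic
  counts both.\<close>

definition content :: "'a formula list \<Rightarrow> nat set \<Rightarrow> 'a formula multiset" where
  "content Fs \<Gamma> = image_mset ((!) Fs) (mset_set \<Gamma>)"

text \<open>Common core of the injective renumberings: shift, transposition and opening a gap, as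
  well as \<open>merge_at\<close> away from the two merged positions. For infinite
  \<open>\<Gamma>\<close> both sides are empty.\<close>

lemma content_image:
  assumes "inj_on f \<Gamma>" "\<And>i. i \<in> \<Gamma> \<Longrightarrow> Gs ! f i = Fs ! i"
  shows "content Gs (f ` \<Gamma>) = content Fs \<Gamma>"
proof (cases "finite \<Gamma>")
  case True
  then show ?thesis
    using assms by (auto simp: content_def multiset.map_comp
      simp flip: image_mset_mset_set intro!: image_mset_cong)
next
  case False
  then have "infinite (f ` \<Gamma>)" using assms(1) finite_imageD by blast
  then show ?thesis using False by (simp add: content_def)
qed

lemma content_insert: "finite \<Gamma> \<Longrightarrow> i \<notin> \<Gamma> \<Longrightarrow> content Fs (insert i \<Gamma>) = add_mset (Fs ! i) (content Fs \<Gamma>)"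
  by (simp add: content_def)

lemma content_append: "\<Gamma> \<subseteq> {..<length Fs} \<Longrightarrow> content (Fs @ Gs) \<Gamma> = content Fs \<Gamma>"
  unfolding content_def by (rule image_mset_cong) (cases "finite \<Gamma>"; auto simp: nth_append)

lemma content_shift: "content (Fs @ Gs) ((\<lambda>j. j + length Fs) ` \<Gamma>) = content Gs \<Gamma>"
  by (rule content_image) (auto simp: nth_append inj_on_def)

lemma content_transpose:
  "content (Fs @ [G, F] @ Gs) (Transposition.transpose (length Fs) (length Fs + 1) ` \<Gamma>)
     = content (Fs @ [F, G] @ Gs) \<Gamma>"
  by (rule content_image) (auto simp: nth_append Transposition.transpose_def inj_on_def nth_Cons' split: if_splits)

lemma content_open_at:
  "content (Fs @ [F] @ Gs) (open_at (length Fs) ` \<Gamma>) = content (Fs @ Gs) \<Gamma>"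
  by (rule content_image) (auto simp: nth_append open_at_def inj_on_def nth_Cons' Suc_diff_le split: if_splits)

text \<open>Inclusion-exclusion for multisets. The content of the intersection is the surplus left
  when two separate contexts are compared with the union of the ogroups.\<close>

lemma content_union_inter:
  "finite \<Gamma> \<Longrightarrow> finite \<Delta> \<Longrightarrow>
    content Fs (\<Gamma> \<union> \<Delta>) + content Fs (\<Gamma> \<inter> \<Delta>) = content Fs \<Gamma> + content Fs \<Delta>"
  unfolding content_def image_mset_union[symmetric]
  by (intro arg_cong[of _ _ "image_mset _"] multiset_eqI) (auto simp: count_mset_set')

lemma content_mono: "finite \<Delta> \<Longrightarrow> \<Gamma> \<subseteq> \<Delta> \<Longrightarrow> content Fs \<Gamma> \<subseteq># content Fs \<Delta>"
  unfolding content_def by (meson image_mset_subseteq_mono subset_imp_msubset_mset_set)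

lemma content_pair:
  assumes "finite \<Gamma>" "n = length Fs"
  shows "content (Fs @ [F, G] @ Gs) \<Gamma> =
    (if n \<in> \<Gamma> then {#F#} else {#}) + (if Suc n \<in> \<Gamma> then {#G#} else {#}) +
    content (Fs @ [F, G] @ Gs) (\<Gamma> - {n, Suc n})"
proof -
  have "(\<Gamma> - {n, Suc n}) \<union> (\<Gamma> \<inter> {n, Suc n}) = \<Gamma>" "(\<Gamma> - {n, Suc n}) \<inter> (\<Gamma> \<inter> {n, Suc n}) = {}" by auto
  then have "content (Fs @ [F, G] @ Gs) \<Gamma> =
      content (Fs @ [F, G] @ Gs) (\<Gamma> - {n, Suc n}) + content (Fs @ [F, G] @ Gs) (\<Gamma> \<inter> {n, Suc n})"
    using content_union_inter[of "\<Gamma> - {n, Suc n}" "\<Gamma> \<inter> {n, Suc n}" "Fs @ [F, G] @ Gs"] assms(1)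
    by (simp only: finite_Diff finite_Int) (simp add: content_def)
  moreover have "content (Fs @ [F, G] @ Gs) (\<Gamma> \<inter> {n, Suc n}) =
      (if n \<in> \<Gamma> then {#F#} else {#}) + (if Suc n \<in> \<Gamma> then {#G#} else {#})"
    by (auto simp: content_def Int_insert_right nth_append assms(2))
  ultimately show ?thesis by simp
qed

text \<open>\<open>merge_at n\<close> is injective off \<open>n\<close> and \<open>Suc n\<close> and
  never takes the value \<open>n\<close> there, so the remaining oformulas keep their content and at
  most one copy of \<open>H\<close> is added.\<close>

lemma content_merge_at:
  assumes "finite \<Gamma>" "n = length Fs"
  shows "content (Fs @ [H] @ Gs) (merge_at n ` \<Gamma>) =
    (if n \<in> \<Gamma> \<or> Suc n \<in> \<Gamma> then {#H#} else {#}) +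
    content (Fs @ [F, G] @ Gs) (\<Gamma> - {n, Suc n})"
proof -
  let ?\<Gamma> = "\<Gamma> - {n, Suc n}"
  have *: "content (Fs @ [H] @ Gs) (merge_at n ` ?\<Gamma>) = content (Fs @ [F, G] @ Gs) ?\<Gamma>"
    by (rule content_image)
      (auto simp: merge_at_def inj_on_def nth_append nth_Cons' assms(2) split: if_splits)
  have n: "n \<notin> merge_at n ` ?\<Gamma>" by (auto simp: merge_at_def)
  have im: "merge_at n ` \<Gamma> = merge_at n ` ?\<Gamma> \<union> merge_at n ` (\<Gamma> \<inter> {n, Suc n})"
    unfolding image_Un[symmetric] Un_Diff_Int ..
  have im_pair: "merge_at n ` (\<Gamma> \<inter> {n, Suc n}) = (if n \<in> \<Gamma> \<or> Suc n \<in> \<Gamma> then {n} else {})"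
    by (simp add: Int_insert_right merge_at_def)
  show ?thesis
  proof (cases "n \<in> \<Gamma> \<or> Suc n \<in> \<Gamma>")
    case True
    then have "merge_at n ` \<Gamma> = insert n (merge_at n ` ?\<Gamma>)" unfolding im im_pair by simp
    then have "content (Fs @ [H] @ Gs) (merge_at n ` \<Gamma>) =
        add_mset ((Fs @ [H] @ Gs) ! n) (content (Fs @ [F, G] @ Gs) ?\<Gamma>)"
      by (simp only: content_insert[OF finite_imageI[OF finite_Diff[OF assms(1)]] n] *)
    then show ?thesis using True by (simp add: assms(2))
  next
    case False
    then have "?\<Gamma> = \<Gamma>" by auto
    then show ?thesis using * False by simp
  qed
qed

text \<open>Names the common remainder \<open>M\<close>, so that contraction and disjunction become
  a case distinction on which of the two indices lie in the ogroup.\<close>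

lemma content_pair_merge_at:
  assumes "finite \<Gamma>" "n = length Fs"
  obtains M where
    "content (Fs @ [F, G] @ Gs) \<Gamma> =
      (if n \<in> \<Gamma> then {#F#} else {#}) + (if Suc n \<in> \<Gamma> then {#G#} else {#}) + M"
    "content (Fs @ [H] @ Gs) (merge_at n ` \<Gamma>) = (if n \<in> \<Gamma> \<or> Suc n \<in> \<Gamma> then {#H#} else {#}) + M"
  using content_pair[OF assms] content_merge_at[OF assms] by blast

section \<open>Ogroups produced by conjunction introduction\<close>

lemma and_applicableD:
  assumes "and_applicable n st" "i < length st"
  shows "n \<in> st ! i \<Longrightarrow> n + 1 \<notin> st ! i"
    and "n \<in> st ! i \<Longrightarrow> i + 1 < length st \<and> n + 1 \<in> st ! (i + 1)"
    and "n + 1 \<in> st ! i \<Longrightarrow> i > 0 \<and> n \<in> st ! (i - 1)"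
  using assms unfolding and_applicable_def by blast+

text \<open>As \<open>\<Gamma>\<close> starts no pair, the next ogroup is not the second half of
  one, and dropping \<open>\<Gamma>\<close> orphans nothing.\<close>

lemma and_applicable_tl:
  assumes "and_applicable n (\<Gamma> # st)" "n \<notin> \<Gamma>"
  shows "and_applicable n st"
  unfolding and_applicable_def
proof (intro conjI allI impI)
  fix i assume i: "i < length st"
  then have "Suc i < length (\<Gamma> # st)" by simp
  note D = and_applicableD[OF assms(1) this]
  show "\<not> (n \<in> st ! i \<and> n + 1 \<in> st ! i)" using D(1) by auto
  show "i + 1 < length st" "n + 1 \<in> st ! (i + 1)" if "n \<in> st ! i"
    using D(2) that by simp_all
  show "0 < i" "n \<in> st ! (i - 1)" if "n + 1 \<in> st ! i"
    using D(3) that assms(2) by (cases i; simp)+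
qed

lemma and_applicable_hd:
  assumes "and_applicable n (\<Gamma> # st)"
  shows "n + 1 \<notin> \<Gamma>" "n \<in> \<Gamma> \<Longrightarrow> \<exists>\<Delta> st'. st = \<Delta> # st' \<and> n + 1 \<in> \<Delta> \<and> n \<notin> \<Delta>"
proof -
  show "n + 1 \<notin> \<Gamma>"
    using and_applicableD(3)[OF assms, of 0] by auto
  assume "n \<in> \<Gamma>"
  then have "1 < length (\<Gamma> # st)" "n + 1 \<in> (\<Gamma> # st) ! 1"
    using and_applicableD(2)[OF assms, of 0] by simp_all
  then show "\<exists>\<Delta> st'. st = \<Delta> # st' \<and> n + 1 \<in> \<Delta> \<and> n \<notin> \<Delta>"
    using and_applicableD(1)[OF assms, of 1] by (cases st) auto
qed

lemma and_applicable_tl2: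
  assumes "and_applicable n (\<Gamma> # \<Delta> # st)" "n \<in> \<Gamma>"
  shows "and_applicable n st"
  unfolding and_applicable_def
proof (intro conjI allI impI)
  have \<Delta>: "n \<notin> \<Delta>" using and_applicable_hd(2)[OF assms] by auto
  fix i assume i: "i < length st"
  then have "Suc (Suc i) < length (\<Gamma> # \<Delta> # st)" by simp
  note D = and_applicableD[OF assms(1) this]
  show "\<not> (n \<in> st ! i \<and> n + 1 \<in> st ! i)" using D(1) by auto
  show "i + 1 < length st" "n + 1 \<in> st ! (i + 1)" if "n \<in> st ! i"
    using D(2) that by simp_all
  show "0 < i" "n \<in> st ! (i - 1)" if "n + 1 \<in> st ! i"
    using D(3) that \<Delta> by (cases i; simp)+
qed

text \<open>Follows the recursion of \<open>unite_pairs\<close>. After a united pair the position in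
  the structure is shifted by two, otherwise by one.\<close>

lemma in_unite_pairs:
  assumes "and_applicable n st" "X \<in> set (unite_pairs n st)"
  shows "(X \<in> set st \<and> n \<notin> X \<and> Suc n \<notin> X) \<or>
    (\<exists>i. Suc i < length st \<and> X = st ! i \<union> st ! Suc i \<and>
      n \<in> st ! i \<and> Suc n \<notin> st ! i \<and> n \<notin> st ! Suc i \<and> Suc n \<in> st ! Suc i)"
  using assms
proof (induction n st rule: unite_pairs.induct)
  case (1 n \<Gamma> \<Delta> st)
  note hd = and_applicable_hd[OF 1(3)]
  show ?case
  proof (cases "n \<in> \<Gamma>")
    case True
    then have \<Delta>: "n + 1 \<in> \<Delta>" "n \<notin> \<Delta>" using hd by auto
    then consider "X = \<Gamma> \<union> \<Delta>" | "X \<in> set (unite_pairs n st)" using 1(4) True by auto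
    then show ?thesis
    proof cases
      case 1
      then show ?thesis using True \<Delta> hd by (intro disjI2 exI[of _ 0]) auto
    next
      case 2
      from "1.IH"(1)[OF conjI[OF True \<Delta>(1)] and_applicable_tl2[OF "1.prems"(1) True] 2]
      show ?thesis
      proof (elim disjE exE)
        fix i assume "Suc i < length st \<and> X = st ! i \<union> st ! Suc i \<and>
          n \<in> st ! i \<and> Suc n \<notin> st ! i \<and> n \<notin> st ! Suc i \<and> Suc n \<in> st ! Suc i"
        then show ?thesis by (intro disjI2 exI[of _ "Suc (Suc i)"]) auto
      qed auto
    qed
  next
    case False
    then consider "X = \<Gamma>" | "X \<in> set (unite_pairs n (\<Delta> # st))" using 1(4) by auto
    then show ?thesis
    proof cases
      case 1
      then show ?thesis using False hd by auto
    next
      case 2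
      have "\<not> (n \<in> \<Gamma> \<and> n + 1 \<in> \<Delta>)" using False by simp
      from "1.IH"(2)[OF this and_applicable_tl[OF "1.prems"(1) False] 2]
      show ?thesis
      proof (elim disjE exE)
        fix i assume "Suc i < length (\<Delta> # st) \<and> X = (\<Delta> # st) ! i \<union> (\<Delta> # st) ! Suc i \<and>
          n \<in> (\<Delta> # st) ! i \<and> Suc n \<notin> (\<Delta> # st) ! i \<and> n \<notin> (\<Delta> # st) ! Suc i \<and> Suc n \<in> (\<Delta> # st) ! Suc i"
        then show ?thesis by (intro disjI2 exI[of _ "Suc i"]) auto
      qed auto
    qed
  qed
next
  case ("2_2" n \<Gamma>)
  then show ?case using and_applicable_hd[of n \<Gamma> "[]"] by auto
qed auto

section \<open>Soundness of the cirquent rules, ogroup by ogroup\<close>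

definition ogroups_derivable :: "seq_rule set \<Rightarrow> 'a cirquent \<Rightarrow> bool" where
  "ogroups_derivable S C \<longleftrightarrow> (\<forall>\<Gamma>\<in>set (fst C). mset_derivable S (content (snd C) \<Gamma>))"

text \<open>The sequent rule adds the contexts of the two ogroups, whereas the united ogroup counts
  a shared oformula once. The excess is the content of the intersection: it is contracted away, or
  it is empty by primitiveness.\<close>

lemma (in affine_rules) ogroups_derivable_and:
  assumes "ogroups_derivable S (st, Fs @ [F, G] @ Gs)"
    and cirq: "is_cirquent (st, Fs @ [F, G] @ Gs)"
    and prim: "primitive (st, Fs @ [F, G] @ Gs) \<or> SContraction \<in> S"
    and app: "and_applicable (length Fs) st"
  shows "ogroups_derivable S
    (map (image (merge_at (length Fs))) (unite_pairs (length Fs) st), Fs @ [And F G] @ Gs)"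
  unfolding ogroups_derivable_def
proof
  let ?n = "length Fs" and ?c = "content (Fs @ [F, G] @ Gs)"
  fix Y assume "Y \<in> set (fst (map (image (merge_at ?n)) (unite_pairs ?n st), Fs @ [And F G] @ Gs))"
  then obtain X where X: "X \<in> set (unite_pairs ?n st)" and Y: "Y = merge_at ?n ` X" by auto
  have fin: "finite \<Gamma>" if "\<Gamma> \<in> set st" for \<Gamma>
    using cirq that finite_subset unfolding is_cirquent_def by fastforce
  have der: "mset_derivable S (?c \<Gamma>)" if "\<Gamma> \<in> set st" for \<Gamma>
    using assms(1) that by (auto simp: ogroups_derivable_def)
  have "mset_derivable S (content (Fs @ [And F G] @ Gs) (merge_at ?n ` X))"
    using in_unite_pairs[OF app X]
  proof (elim disjE exE conjE)
    assume *: "X \<in> set st" "?n \<notin> X" "Suc ?n \<notin> X"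
    then have "X - {?n, Suc ?n} = X" by auto
    with * show ?thesis
      using der fin content_merge_at[of X ?n Fs "And F G" Gs F G] by simp
  next
    fix i
    let ?\<Gamma> = "st ! i" and ?\<Delta> = "st ! Suc i"
    let ?\<Gamma>' = "?\<Gamma> - {?n, Suc ?n}" and ?\<Delta>' = "?\<Delta> - {?n, Suc ?n}"
    assume i: "Suc i < length st" and X: "X = ?\<Gamma> \<union> ?\<Delta>"
      and mem: "?n \<in> ?\<Gamma>" "Suc ?n \<notin> ?\<Gamma>" "?n \<notin> ?\<Delta>" "Suc ?n \<in> ?\<Delta>"
    have st: "?\<Gamma> \<in> set st" "?\<Delta> \<in> set st" using i by auto
    have "mset_derivable S (add_mset F (?c ?\<Gamma>'))" "mset_derivable S (add_mset G (?c ?\<Delta>'))"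
      using der[OF st(1)] der[OF st(2)] mem
        content_pair[OF fin[OF st(1)] refl, of Fs F G Gs] content_pair[OF fin[OF st(2)] refl, of Fs F G Gs]
      by simp_all
    then have "mset_derivable S (add_mset (And F G) (?c ?\<Gamma>' + ?c ?\<Delta>'))"
      by (rule mset_derivable_and)
    \<comment> \<open>The added contexts are split into the wanted content and the excess.\<close>
    then have d: "mset_derivable S (add_mset (And F G) (?c (?\<Gamma>' \<union> ?\<Delta>')) + ?c (?\<Gamma>' \<inter> ?\<Delta>'))"
      using content_union_inter[of ?\<Gamma>' ?\<Delta>' "Fs @ [F, G] @ Gs"] fin[OF st(1)] fin[OF st(2)] by simp
    have "mset_derivable S (add_mset (And F G) (?c (?\<Gamma>' \<union> ?\<Delta>')))"
    proof (cases "SContraction \<in> S")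
      case True
      have "?c (?\<Gamma>' \<inter> ?\<Delta>') \<subseteq># ?c (?\<Gamma>' \<union> ?\<Delta>')"
        using fin[OF st(1)] fin[OF st(2)] by (intro content_mono) auto
      then have "?c (?\<Gamma>' \<inter> ?\<Delta>') \<subseteq># add_mset (And F G) (?c (?\<Gamma>' \<union> ?\<Delta>'))"
        by (rule subset_mset.order_trans) simp
      then show ?thesis using mset_derivable_contractions[OF True d] by simp
    next
      case False
      then have "?\<Gamma> \<inter> ?\<Delta> = {}"
        using prim i by (auto simp: primitive_def disjoint_family_on_def)
      then have "?\<Gamma>' \<inter> ?\<Delta>' = {}" by auto
      then show ?thesis using d by (simp add: content_def)
    qed
    moreover have "X - {?n, Suc ?n} = ?\<Gamma>' \<union> ?\<Delta>'" using X by auto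
    ultimately show ?thesis
      using content_merge_at[of X ?n Fs "And F G" Gs F G] X mem fin[OF st(1)] fin[OF st(2)] by simp
  qed
  then show "mset_derivable S (content (snd (map (image (merge_at ?n)) (unite_pairs ?n st), Fs @ [And F G] @ Gs)) Y)"
    using Y by simp
qed

lemma (in affine_rules) ogroups_derivable_inference:
  assumes "cirq_inference r ps C"
    and "r = CContraction \<Longrightarrow> SContraction \<in> S"
    and "\<And>p. p \<in> set ps \<Longrightarrow> is_cirquent p \<and> (primitive p \<or> SContraction \<in> S) \<and> ogroups_derivable S p"
  shows "ogroups_derivable S C"
  using assms
proof (cases rule: cirq_inference.cases)
  case axiom_empty
  then show ?thesis by (simp add: ogroups_derivable_def)
next
  case (axiom_id F)
  have "content [neg F, F] {0, 1} = {#neg F, F#}" by (simp add: content_def)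
  then show ?thesis using axiom_id mset_derivable_axiom by (simp add: ogroups_derivable_def)
next
  case (mix st Fs st' Gs)
  have "\<Gamma> \<subseteq> {..<length Fs}" if "\<Gamma> \<in> set st" for \<Gamma>
    using assms(3)[of "(st, Fs)"] mix that by (auto simp: is_cirquent_def)
  then show ?thesis
    using assms(3)[of "(st, Fs)"] assms(3)[of "(st', Gs)"] mix
    by (auto simp: ogroups_derivable_def content_append content_shift)
next
  case (exchange_oformulas st Fs F G Gs)
  then show ?thesis using assms(3)
    by (auto simp: ogroups_derivable_def content_transpose[simplified])
next
  case (weakening_ogroup i Fs st \<Gamma> st')
  then have "finite \<Gamma>" "ogroups_derivable S (st @ [\<Gamma>] @ st', Fs)"
    using assms(3) finite_subset by (fastforce simp: is_cirquent_def)+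
  \<comment> \<open>If \<open>i\<close> already lies in \<open>\<Gamma>\<close>, the ogroup does not
    change; otherwise one sequent weakening is used.\<close>
  moreover from this have "mset_derivable S (content Fs (insert i \<Gamma>))"
    using mset_derivable_weakening
    by (cases "i \<in> \<Gamma>") (auto simp: ogroups_derivable_def content_insert insert_absorb)
  ultimately show ?thesis using weakening_ogroup by (auto simp: ogroups_derivable_def)
next
  case (weakening_pool st Fs Gs F)
  then show ?thesis using assms(3)
    by (auto simp: ogroups_derivable_def content_open_at[simplified])
next
  case (contraction st Fs F Gs)
  have S: "SContraction \<in> S" using contraction assms(2) by simp
  have "mset_derivable S (content (Fs @ [F] @ Gs) (merge_at (length Fs) ` \<Gamma>))" if "\<Gamma> \<in> set st" for \<Gamma>
  proof -
    have "finite \<Gamma>" "mset_derivable S (content (Fs @ [F, F] @ Gs) \<Gamma>)"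
      using assms(3) contraction that finite_subset
      by (fastforce simp: is_cirquent_def ogroups_derivable_def)+
    then show ?thesis
      \<comment> \<open>Only an ogroup containing both copies of \<open>F\<close> costs a
        contraction.\<close>
      using mset_derivable_contraction[OF S]
      by (rule_tac content_pair_merge_at[OF \<open>finite \<Gamma>\<close> refl, of Fs F F Gs F]) (simp split: if_splits)
  qed
  then show ?thesis using contraction by (simp add: ogroups_derivable_def)
next
  case (or_intro st Fs F G Gs)
  have "mset_derivable S (content (Fs @ [Or F G] @ Gs) (merge_at (length Fs) ` \<Gamma>))" if "\<Gamma> \<in> set st" for \<Gamma>
  proof -
    have "finite \<Gamma>" "mset_derivable S (content (Fs @ [F, G] @ Gs) \<Gamma>)"
      using assms(3) or_intro that finite_subset
      by (fastforce simp: is_cirquent_def ogroups_derivable_def)+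
    \<comment> \<open>An ogroup may contain just one of the disjuncts; the other is then supplied by
      weakening.\<close>
    moreover have "mset_derivable S (add_mset (Or F G) M)" if "mset_derivable S (add_mset F M)" for M
      by (rule mset_derivable_or, subst add_mset_commute) (rule mset_derivable_weakening[OF that])
    moreover have "mset_derivable S (add_mset (Or F G) M)" if "mset_derivable S (add_mset G M)" for M
      by (rule mset_derivable_or) (rule mset_derivable_weakening[OF that])
    ultimately show ?thesis
      using mset_derivable_or[of F G, unfolded add_mset_commute[of F G]]
      by (rule_tac content_pair_merge_at[OF \<open>finite \<Gamma>\<close> refl, of Fs F G Gs "Or F G"])
        (simp split: if_splits)
  qed
  then show ?thesis using or_intro by (simp add: ogroups_derivable_def)
next
  case (and_intro Fs st F G Gs)
  then show ?thesis using assms(3) ogroups_derivable_and[of st Fs F G Gs] by simp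
qed (auto simp: ogroups_derivable_def)

text \<open>Keeping \<open>P\<close> abstract covers both uses: starred systems, where
  \<open>P\<close> gives primitiveness, and unrestricted ones, where \<open>S\<close>
  contracts.\<close>

lemma (in affine_rules) ogroups_derivable_derivable:
  assumes "derivable (cirq_step R) P C"
    and "CContraction \<in> R \<Longrightarrow> SContraction \<in> S"
    and "\<And>C. P C \<Longrightarrow> is_cirquent C \<and> (primitive C \<or> SContraction \<in> S)"
  shows "ogroups_derivable S C"
  using assms(1)
proof (induction rule: derivable.induct)
  case (step ps c)
  then obtain r where r: "r \<in> R" "cirq_inference r ps c" by auto
  show ?case
  proof (rule ogroups_derivable_inference[OF r(2)])
    show "SContraction \<in> S" if "r = CContraction" using that r(1) assms(2) by simp
    fix p assume p: "p \<in> set ps"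
    have "P p" by (rule derivable_invariant[OF step.hyps(3)[OF p]])
    then show "is_cirquent p \<and> (primitive p \<or> SContraction \<in> S) \<and> ogroups_derivable S p"
      using assms(3) step.IH[OF p] by simp
  qed
qed

lemma (in affine_rules) seq_derivable_if_formula_cirquent:
  assumes "ogroups_derivable S (formula_cirquent F)"
  shows "seq_derivable S [F]"
proof -
  have "mset_derivable S (mset [F])"
    using assms by (simp add: ogroups_derivable_def formula_cirquent_def content_def)
  then show ?thesis unfolding mset_derivable_mset[OF rules(2)] .
qed

section \<open>From sequents to cirquents\<close>

definition seq_cirquent :: "'a sequent \<Rightarrow> 'a cirquent" where
  "seq_cirquent \<Gamma> = ([{..<length \<Gamma>}], \<Gamma>)"

lemma is_cirquent_seq_cirquent: "is_cirquent (seq_cirquent \<Gamma>) \<and> primitive (seq_cirquent \<Gamma>)"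
  by (auto simp: seq_cirquent_def is_cirquent_def primitive_def disjoint_family_on_def)

lemma image_merge_at_lessThan: "n < k \<Longrightarrow> merge_at n ` {..<Suc k} = {..<k}"
proof
  assume "n < k"
  show "{..<k} \<subseteq> merge_at n ` {..<Suc k}"
  proof
    fix i assume "i \<in> {..<k}"
    then show "i \<in> merge_at n ` {..<Suc k}"
      by (cases "i \<le> n") (auto simp: merge_at_def image_iff intro: bexI[of _ i] bexI[of _ "Suc i"])
  qed
qed (auto simp: merge_at_def)

text \<open>Every sequent rule has a cirquent counterpart on the single full ogroup. Only weakening
  and conjunction pass through another cirquent, whose primitiveness has to be checked.\<close>

lemma star_derivable_seq_cirquent:
  assumes "UNIV - {CContraction} \<subseteq> R" "SContraction \<in> S \<Longrightarrow> CContraction \<in> R"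
    and "seq_derivable S \<Gamma>"
  shows "star_derivable R (seq_cirquent \<Gamma>)"
  using assms(3)
proof (induction rule: derivable.induct)
  case (step ps c)
  have rules: "CAxiom \<in> R" "CMix \<in> R" "CExchange \<in> R" "CWeakening \<in> R" "COr \<in> R" "CAnd \<in> R"
    using assms(1) by auto
  obtain r where r: "r \<in> S" "seq_inference r ps c" using step by auto
  have one: "star_derivable R C'"
    if "star_derivable R C" "cirq_inference r [C] C'" "r \<in> R" "is_cirquent C' \<and> primitive C'"
    for r and C C' :: "'a cirquent"
    by (rule derivable_step1[OF that(1) _ that(4)]) (use that in auto)
  from r(2) show ?case
  proof (cases rule: seq_inference.cases)
    case (1 F)
    have "cirq_inference CAxiom [] (seq_cirquent [neg F, F])"
      using axiom_id[of F] by (simp add: seq_cirquent_def lessThan_Suc insert_commute)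
    then show ?thesis
      using 1 rules is_cirquent_seq_cirquent by (intro derivable_step0) auto
  next
    case (2 \<Gamma> F G \<Delta>)
    have "Transposition.transpose (length \<Gamma>) (length \<Gamma> + 1) ` {..<length \<Gamma> + 2 + length \<Delta>} =
        {..<length \<Gamma> + 2 + length \<Delta>}"
      by (rule transpose_image_eq) auto
    then have inf: "cirq_inference CExchange [seq_cirquent (\<Gamma> @ [F, G] @ \<Delta>)] (seq_cirquent c)"
      using exchange_oformulas[of "[{..<length \<Gamma> + 2 + length \<Delta>}]" \<Gamma> F G \<Delta>] 2
      by (simp add: seq_cirquent_def)
    then show ?thesis
      using 2 rules step.IH by (intro one[OF _ inf _ is_cirquent_seq_cirquent]) auto
  next
    case (3 \<Gamma> \<Delta> F)
    \<comment> \<open>Inserting \<open>F\<close> into the pool leaves it outside the ogroup; a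
      second weakening then puts its index in.\<close>
    let ?C = "([open_at (length \<Gamma>) ` {..<length \<Gamma> + length \<Delta>}], \<Gamma> @ [F] @ \<Delta>)"
    have eq: "insert (length \<Gamma>) (open_at (length \<Gamma>) ` {..<length \<Gamma> + length \<Delta>}) =
        {..<length \<Gamma> + Suc (length \<Delta>)}"
    proof
      show "{..<length \<Gamma> + Suc (length \<Delta>)} \<subseteq>
          insert (length \<Gamma>) (open_at (length \<Gamma>) ` {..<length \<Gamma> + length \<Delta>})"
      proof
        fix i assume "i \<in> {..<length \<Gamma> + Suc (length \<Delta>)}"
        then show "i \<in> insert (length \<Gamma>) (open_at (length \<Gamma>) ` {..<length \<Gamma> + length \<Delta>})"
          by (cases "i < length \<Gamma>"; cases i)
            (auto simp: open_at_def image_iff intro: bexI[of _ i] bexI[of _ "i - 1"])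
      qed
    qed (auto simp: open_at_def)
    have inf1: "cirq_inference CWeakening [seq_cirquent (\<Gamma> @ \<Delta>)] ?C"
      using weakening_pool[of "[{..<length \<Gamma> + length \<Delta>}]" \<Gamma> \<Delta> F] by (simp add: seq_cirquent_def)
    have "is_cirquent ?C \<and> primitive ?C"
      by (auto simp: is_cirquent_def primitive_def disjoint_family_on_def open_at_def)
    then have "star_derivable R ?C"
      using step.IH 3 rules by (intro one[OF _ inf1]) auto
    moreover have inf2: "cirq_inference CWeakening [?C] (seq_cirquent c)"
      using weakening_ogroup[of "length \<Gamma>" "\<Gamma> @ [F] @ \<Delta>" "[]"
          "open_at (length \<Gamma>) ` {..<length \<Gamma> + length \<Delta>}" "[]"] 3 eq
      by (simp add: seq_cirquent_def)
    ultimately show ?thesis using rules by (intro one[OF _ inf2 _ is_cirquent_seq_cirquent])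
  next
    case (4 \<Gamma> F \<Delta>)
    have inf: "cirq_inference CContraction [seq_cirquent (\<Gamma> @ [F, F] @ \<Delta>)] (seq_cirquent c)"
      using contraction[of "[{..<Suc (Suc (length \<Gamma> + length \<Delta>))}]" \<Gamma> F \<Delta>] 4
      by (simp add: seq_cirquent_def image_merge_at_lessThan)
    then show ?thesis
      using 4 r assms(2) step.IH by (intro one[OF _ inf _ is_cirquent_seq_cirquent]) auto
  next
    case (5 \<Gamma> F G \<Delta>)
    have inf: "cirq_inference COr [seq_cirquent (\<Gamma> @ [F, G] @ \<Delta>)] (seq_cirquent c)"
      using or_intro[of "[{..<Suc (Suc (length \<Gamma> + length \<Delta>))}]" \<Gamma> F G \<Delta>] 5
      by (simp add: seq_cirquent_def image_merge_at_lessThan)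
    then show ?thesis
      using 5 rules step.IH by (intro one[OF _ inf _ is_cirquent_seq_cirquent]) auto
  next
    case (6 \<Gamma> F G \<Delta>)
    let ?n = "length \<Gamma>"
    let ?X = "{..<Suc ?n}" and ?Y = "(\<lambda>j. j + Suc ?n) ` {..<Suc (length \<Delta>)}"
    \<comment> \<open>The result of mix: two adjacent disjoint intervals. \<open>F\<close> is the
      last index of the first and \<open>G\<close> the first index of the second, so they form
      exactly one pair for conjunction introduction.\<close>
    let ?C = "([?X, ?Y], \<Gamma> @ [F, G] @ \<Delta>)"
    have Y: "?Y = {Suc ?n..<Suc (Suc (?n + length \<Delta>))}"
      using image_add_atLeastLessThan'[of "Suc ?n" 0 "Suc (length \<Delta>)"]
      by (simp add: lessThan_atLeast0 add.commute)
    have "cirq_inference CMix [seq_cirquent (\<Gamma> @ [F]), seq_cirquent ([G] @ \<Delta>)] ?C"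
      using mix[of "[?X]" "\<Gamma> @ [F]" "[{..<Suc (length \<Delta>)}]" "[G] @ \<Delta>"] by (simp add: seq_cirquent_def)
    moreover have "is_cirquent ?C \<and> primitive ?C"
      unfolding Y by (auto simp: is_cirquent_def primitive_def disjoint_family_on_def nth_Cons' split: if_splits)
    ultimately have C: "star_derivable R ?C"
      using step 6 rules
      by (intro derivable_step2[of _ _ "seq_cirquent (\<Gamma> @ [F])" "seq_cirquent ([G] @ \<Delta>)" ?C]) auto
    have app: "and_applicable ?n [?X, ?Y]"
      unfolding Y by (auto simp: and_applicable_def nth_Cons' split: if_splits)
    have "?X \<union> ?Y = {..<Suc (Suc (?n + length \<Delta>))}" unfolding Y by auto
    then have "unite_pairs ?n [?X, ?Y] = [{..<Suc (Suc (?n + length \<Delta>))}]"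
      by (simp add: image_iff)
    then have inf: "cirq_inference CAnd [?C] (seq_cirquent c)"
      using and_intro[OF app, of F G \<Delta>] 6 by (simp add: seq_cirquent_def image_merge_at_lessThan)
    show ?thesis by (rule one[OF C inf rules(6) is_cirquent_seq_cirquent])
  qed
qed

section \<open>Comparison of the sets of theorems\<close>

lemma seq_theorems_eq_star_theorems:
  assumes "UNIV - {SContraction} \<subseteq> S" "UNIV - {CContraction} \<subseteq> R"
    and "SContraction \<in> S \<longleftrightarrow> CContraction \<in> R"
  shows "seq_theorems S = star_theorems R"
proof -
  interpret affine_rules S using assms(1) by unfold_locales
  have "seq_derivable S [F] \<longleftrightarrow> star_derivable R (formula_cirquent F)" for F :: "'a formula"
  proof
    assume "seq_derivable S [F]"
    from star_derivable_seq_cirquent[OF assms(2) _ this] assms(3)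
    show "star_derivable R (formula_cirquent F)"
      by (simp add: seq_cirquent_def formula_cirquent_def lessThan_Suc)
  next
    assume "star_derivable R (formula_cirquent F)"
    from ogroups_derivable_derivable[OF this] assms(3)
    show "seq_derivable S [F]"
      using seq_derivable_if_formula_cirquent by blast
  qed
  then show ?thesis by (auto simp: seq_theorems_iff star_theorems_iff)
qed

text \<open>Contraction on the sequent side absorbs the oformulas shared between ogroups, so
  arbitrary cirquents are sound here.\<close>

lemma cirq_theorems_subset_Classical:
  "cirq_theorems R \<subseteq> seq_theorems Classical_logic"
proof -
  interpret affine_rules Classical_logic by unfold_locales (simp add: Classical_logic_def)
  have "seq_derivable Classical_logic [F]" if "cirq_derivable R (formula_cirquent F)"
    for F :: "'a formula"
    using seq_derivable_if_formula_cirquent ogroups_derivable_derivable[OF that]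
    by (simp add: Classical_logic_def)
  then show ?thesis by (auto simp: seq_theorems_iff cirq_theorems_iff)
qed

section \<open>Blass's principle\<close>

text \<open>
  A sequent of \<open>x\<close> literals \<open>p\<close>, \<open>y\<close> literals \<open>\<not>p\<close>, \<open>u\<close> copies of \<open>A \<and> A\<close> and \<open>v\<close> copies of \<open>C \<and> C\<close>
  is provable in affine logic only if the following holds. The condition fails for \<open>A \<and> A, C \<and> C\<close>,
  but holds as soon as any formula of the four kinds is added.
\<close>

definition good_counts :: "nat \<Rightarrow> nat \<Rightarrow> nat \<Rightarrow> nat \<Rightarrow> bool" where
  "good_counts x y u v \<longleftrightarrow> x \<ge> 1 \<and> y \<ge> 1 \<or> u \<ge> 1 \<and> x \<ge> 2 \<or> v \<ge> 1 \<and> y \<ge> 2 \<or>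
     u \<ge> 1 \<and> v \<ge> 1 \<and> x + y + u + v \<ge> 3"

lemma good_counts_mono:
  "good_counts x y u v \<Longrightarrow> x \<le> x' \<Longrightarrow> y \<le> y' \<Longrightarrow> u \<le> u' \<Longrightarrow> v \<le> v' \<Longrightarrow> good_counts x' y' u' v'"
  unfolding good_counts_def by linarith

text \<open>A good premise that contains \<open>A\<close> must also hold a literal \<open>p\<close>
  or a copy of \<open>C \<and> C\<close>. The two premises thus bring two such formulas, which
  suffice beside the new \<open>A \<and> A\<close>.\<close>

lemma good_counts_and_neg:
  assumes "good_counts x (y + 2) u v" "good_counts x' (y' + 2) u' v'"
  shows "good_counts (x + x') (y + y') (u + u' + 1) (v + v')"
proof -
  have "x + v \<ge> 1" "x' + v' \<ge> 1" using assms unfolding good_counts_def by linarith+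
  then show ?thesis unfolding good_counts_def by linarith
qed

lemma good_counts_and_pos:
  assumes "good_counts (x + 2) y u v" "good_counts (x' + 2) y' u' v'"
  shows "good_counts (x + x') (y + y') (u + u') (v + v' + 1)"
proof -
  have "y + u \<ge> 1" "y' + u' \<ge> 1" using assms unfolding good_counts_def by linarith+
  then show ?thesis unfolding good_counts_def by linarith
qed

context
  fixes p :: 'a
begin

definition "neg2 = Or (NegAtom p) (NegAtom p)"
definition "pos2 = Or (Atom p) (Atom p)"
definition "neg4 = And neg2 neg2"
definition "pos4 = And pos2 pos2"
definition "blass = Or neg4 pos4"

lemmas blass_defs = neg2_def pos2_def neg4_def pos4_def blass_def

text \<open>Four axioms link the four negative literals with the four positive ones so that each
  copy of \<open>neg2\<close> meets each copy of \<open>pos2\<close> in exactly one ogroup. Every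
  disjunction is then shared by two ogroups, which primitive cirquents forbid.\<close>

lemma blass_cirq_derivable: "cirq_derivable CL5 (formula_cirquent blass)"
proof -
  let ?n = "NegAtom p" and ?p = "Atom p"
  have one: "cirq_derivable CL5 C'"
    if "cirq_derivable CL5 C" "cirq_inference r [C] C'" "r \<noteq> CContraction" "is_cirquent C'" for r and C C' :: "'a cirquent"
    by (rule derivable_step1[OF that(1) _ that(4)]) (use that in \<open>auto simp: CL5_def\<close>)
  have two: "cirq_derivable CL5 (st @ map (image (\<lambda>j. j + length Fs)) st', Fs @ Gs)"
    if "cirq_derivable CL5 (st, Fs)" "cirq_derivable CL5 (st', Gs)"
      "is_cirquent (st @ map (image (\<lambda>j. j + length Fs)) st', Fs @ Gs)" for st st' and Fs Gs :: "'a formula list"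
    by (rule derivable_step2[OF that(1,2) _ that(3)]) (use mix[of st Fs st' Gs] in \<open>auto simp: CL5_def\<close>)
  note exch = one[OF _ exchange_oformulas] and exch_ogroups = one[OF _ exchange_ogroups]
    and disj = one[OF _ or_intro] and conj = one[OF _ and_intro]
  \<comment> \<open>The reversed definitions fold each newly introduced connective back into its
    name.\<close>
  note calc = is_cirquent_def Transposition.transpose_def merge_at_def insert_commute eval_nat_numeral
    neg2_def[symmetric] pos2_def[symmetric] neg4_def[symmetric] pos4_def[symmetric] blass_def[symmetric]
  have 1: "cirq_derivable CL5 ([{0, 1}], [?n, ?p])"
    using axiom_id[of ?p] by (intro derivable_step0) (auto simp: CL5_def is_cirquent_def)
  have "cirq_derivable CL5 ([{0, 1}, {2, 3}], [?n, ?p, ?n, ?p])"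
    using two[OF 1 1] by (simp add: calc)
  then have "cirq_derivable CL5 ([{0, 2}, {1, 3}], [?n, ?n, ?p, ?p])"
    using exch[of "[{0, 1}, {2, 3}]" "[?n]" ?p ?n "[?p]"] by (simp add: calc)
  \<comment> \<open>Here sharing begins: \<open>neg2\<close> lies in both ogroups because each
    contained one of its disjuncts.\<close>
  then have 2: "cirq_derivable CL5 ([{0, 1}, {0, 2}], [neg2, ?p, ?p])"
    using disj[of "[{0, 2}, {1, 3}]" "[]" ?n ?n "[?p, ?p]"] by (simp add: calc)
  have "cirq_derivable CL5 ([{0, 1}, {0, 2}, {3, 4}, {3, 5}], [neg2, ?p, ?p, neg2, ?p, ?p])"
    using two[OF 2 2] by (simp add: calc)
  then have "cirq_derivable CL5 ([{0, 1}, {0, 3}, {2, 4}, {2, 5}], [neg2, ?p, neg2, ?p, ?p, ?p])"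
    using exch[of "[{0, 1}, {0, 2}, {3, 4}, {3, 5}]" "[neg2, ?p]" ?p neg2 "[?p, ?p]"] by (simp add: calc)
  then have "cirq_derivable CL5 ([{0, 2}, {0, 3}, {1, 4}, {1, 5}], [neg2, neg2, ?p, ?p, ?p, ?p])"
    using exch[of "[{0, 1}, {0, 3}, {2, 4}, {2, 5}]" "[neg2]" ?p neg2 "[?p, ?p, ?p]"] by (simp add: calc)
  \<comment> \<open>The middle literals are swapped so that each \<open>pos2\<close> will take one
    literal linked to either \<open>neg2\<close>.\<close>
  then have "cirq_derivable CL5 ([{0, 2}, {0, 4}, {1, 3}, {1, 5}], [neg2, neg2, ?p, ?p, ?p, ?p])"
    using exch[of "[{0, 2}, {0, 3}, {1, 4}, {1, 5}]" "[neg2, neg2, ?p]" ?p ?p "[?p]"] by (simp add: calc)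
  then have "cirq_derivable CL5 ([{0, 2}, {0, 3}, {1, 2}, {1, 4}], [neg2, neg2, pos2, ?p, ?p])"
    using disj[of "[{0, 2}, {0, 4}, {1, 3}, {1, 5}]" "[neg2, neg2]" ?p ?p "[?p, ?p]"] by (simp add: calc)
  then have "cirq_derivable CL5 ([{0, 2}, {0, 3}, {1, 2}, {1, 3}], [neg2, neg2, pos2, pos2])"
    using disj[of "[{0, 2}, {0, 3}, {1, 2}, {1, 4}]" "[neg2, neg2, pos2]" ?p ?p "[]"] by (simp add: calc)
  \<comment> \<open>The ogroups with index 0 must each be directly followed by one with index 1. The
    pairs now share a \<open>pos2\<close>, which their union counts once.\<close>
  then have "cirq_derivable CL5 ([{0, 2}, {1, 2}, {0, 3}, {1, 3}], [neg2, neg2, pos2, pos2])"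
    using exch_ogroups[of "[{0, 2}]" "{0, 3}" "{1, 2}" "[{1, 3}]" "[neg2, neg2, pos2, pos2]"]
    by (simp add: is_cirquent_def)
  moreover have "and_applicable 0 [{0, 2}, {1, 2}, {0, 3}, {1, 3}]"
    by (simp add: and_applicable_def eval_nat_numeral All_less_Suc)
  ultimately have "cirq_derivable CL5 ([{0, 1}, {0, 2}], [neg4, pos2, pos2])"
    using conj[of "[{0, 2}, {1, 2}, {0, 3}, {1, 3}]" "[]" neg2 neg2 "[pos2, pos2]"] by (simp add: calc)
  moreover have "and_applicable 1 [{0, 1}, {0, 2}]"
    by (simp add: and_applicable_def eval_nat_numeral All_less_Suc)
  ultimately have "cirq_derivable CL5 ([{0, 1}], [neg4, pos4])"
    using conj[of "[{0, 1}, {0, 2}]" "[neg4]" pos2 pos2 "[]"] by (simp add: calc)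
  then have "cirq_derivable CL5 ([{0}], [blass])"
    using disj[of "[{0, 1}]" "[]" neg4 pos4 "[]"] by (simp add: calc)
  then show ?thesis by (simp add: formula_cirquent_def)
qed

text \<open>\<open>A\<close> and \<open>C\<close> count as two literals each, and the whole formula as its two disjuncts.\<close>

definition literals_pos :: "'a formula \<Rightarrow> nat" where
  "literals_pos F = (if F = Atom p then 1 else if F = pos2 then 2 else 0)"
definition literals_neg :: "'a formula \<Rightarrow> nat" where
  "literals_neg F = (if F = NegAtom p then 1 else if F = neg2 then 2 else 0)"
definition conj_neg :: "'a formula \<Rightarrow> nat" where
  "conj_neg F = (if F = neg4 \<or> F = blass then 1 else 0)"
definition conj_pos :: "'a formula \<Rightarrow> nat" where
  "conj_pos F = (if F = pos4 \<or> F = blass then 1 else 0)"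

lemmas count_defs = literals_pos_def literals_neg_def conj_neg_def conj_pos_def

definition good :: "'a sequent \<Rightarrow> bool" where
  "good \<Gamma> \<longleftrightarrow> good_counts (sum_list (map literals_pos \<Gamma>)) (sum_list (map literals_neg \<Gamma>))
     (sum_list (map conj_neg \<Gamma>)) (sum_list (map conj_pos \<Gamma>))"

abbreviation "blass_subformulas \<equiv> {Atom p, NegAtom p, neg2, pos2, neg4, pos4, blass}"

text \<open>The allowed formulas are closed under passing from a conclusion to its premises, so the
  condition propagates down the derivation: weakening only raises counts, disjunction preserves
  them, and conjunction is handled by \<open>good_counts_and_neg\<close> and
  \<open>good_counts_and_pos\<close>.\<close>

lemma good_if_affine_derivable:
  assumes "seq_derivable Affine_logic \<Gamma>" "set \<Gamma> \<subseteq> blass_subformulas"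
  shows "good \<Gamma>"
  using assms
proof (induction rule: derivable.induct)
  case (step ps c)
  then obtain r where r: "r \<noteq> SContraction" "seq_inference r ps c"
    by (auto simp: Affine_logic_def)
  note IH = step.IH
  from r(2) show ?case
  proof (cases rule: seq_inference.cases)
    case (1 F)
    then have "F \<in> blass_subformulas" "neg F \<in> blass_subformulas" using step.prems by simp_all
    \<comment> \<open>The negation of a compound formula of the list, such as
      \<open>And (Atom p) (Atom p)\<close> for \<open>neg2\<close>, is not in the list.\<close>
    then have "F = Atom p \<or> F = NegAtom p" by (elim insertE) (simp_all add: blass_defs)
    then have "good [neg F, F]"
      by (elim disjE) (simp_all add: good_def good_counts_def literals_pos_def literals_neg_def pos2_def neg2_def)
    then show ?thesis using 1(3) by simp
  next
    case (2 \<Gamma> F G \<Delta>)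
    then have "good (\<Gamma> @ [F, G] @ \<Delta>)" using IH[of "\<Gamma> @ [F, G] @ \<Delta>"] step.prems by simp
    moreover have "sum_list (map f (\<Gamma> @ [F, G] @ \<Delta>)) = sum_list (map f (\<Gamma> @ [G, F] @ \<Delta>))"
      for f :: "'a formula \<Rightarrow> nat" by simp
    ultimately show ?thesis unfolding good_def 2(3) by (simp only:)
  next
    case (3 \<Gamma> \<Delta> F)
    then have "good (\<Gamma> @ \<Delta>)" using IH[of "\<Gamma> @ \<Delta>"] step.prems by simp
    then show ?thesis unfolding good_def 3(3) by (rule good_counts_mono) simp_all
  next
    case 4
    then show ?thesis using r by simp
  next
    case (5 \<Gamma> F G \<Delta>)
    then have FG: "F = Atom p \<and> G = Atom p \<or> F = NegAtom p \<and> G = NegAtom p \<or> F = neg4 \<and> G = pos4"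
      using step.prems by (auto simp: blass_defs)
    then have "good (\<Gamma> @ [F, G] @ \<Delta>)" using 5 IH[of "\<Gamma> @ [F, G] @ \<Delta>"] step.prems by auto
    moreover have "literals_pos (Or F G) = literals_pos F + literals_pos G"
      "literals_neg (Or F G) = literals_neg F + literals_neg G"
      "conj_pos (Or F G) = conj_pos F + conj_pos G" "conj_neg (Or F G) = conj_neg F + conj_neg G"
      using FG by (auto simp: count_defs blass_defs)
    ultimately show ?thesis using 5 by (simp add: good_def add.assoc)
  next
    case (6 \<Gamma> F G \<Delta>)
    then have FG: "F = neg2 \<and> G = neg2 \<or> F = pos2 \<and> G = pos2"
      using step.prems by (auto simp: blass_defs)
    then have g: "good (\<Gamma> @ [F])" "good ([G] @ \<Delta>)"
      using 6 IH[of "\<Gamma> @ [F]"] IH[of "[G] @ \<Delta>"] step.prems by auto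
    from FG show ?thesis
    proof
      assume F: "F = neg2 \<and> G = neg2"
      have "literals_pos neg2 = 0" "literals_neg neg2 = 2" "conj_pos neg2 = 0" "conj_neg neg2 = 0"
        "literals_pos (And neg2 neg2) = 0" "literals_neg (And neg2 neg2) = 0"
        "conj_pos (And neg2 neg2) = 0" "conj_neg (And neg2 neg2) = 1"
        by (simp_all add: count_defs blass_defs)
      then show ?thesis
        using g F good_counts_and_neg unfolding good_def 6(3) by (simp add: add.commute)
    next
      assume F: "F = pos2 \<and> G = pos2"
      have "literals_pos pos2 = 2" "literals_neg pos2 = 0" "conj_pos pos2 = 0" "conj_neg pos2 = 0"
        "literals_pos (And pos2 pos2) = 0" "literals_neg (And pos2 pos2) = 0"
        "conj_pos (And pos2 pos2) = 1" "conj_neg (And pos2 pos2) = 0"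
        by (simp_all add: count_defs blass_defs)
      then show ?thesis
        using g F good_counts_and_pos unfolding good_def 6(3) by (simp add: add.commute)
    qed
  qed
qed

text \<open>The counts of \<open>[blass]\<close> are 0, 0, 1, 1, whose sum 2 is one short of the
  bound in the last disjunct of \<open>good_counts\<close>.\<close>

lemma blass_not_affine: "\<not> seq_derivable Affine_logic [blass]"
proof
  assume "seq_derivable Affine_logic [blass]"
  then have "good [blass]" using good_if_affine_derivable by simp
  then show False by (simp add: good_def good_counts_def count_defs blass_defs)
qed

end

theorem theorem5p2:
  assumes "infinite (UNIV :: 'a set)"
  shows "((seq_theorems Affine_logic :: 'a formula set) = star_theorems CL5 \<and>
      (star_theorems CL5 :: 'a formula set) \<subseteq> cirq_theorems CL5 \<and>
      (cirq_theorems CL5 :: 'a formula set) \<noteq> seq_theorems Affine_logic) \<and>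
    ((seq_theorems Classical_logic :: 'a formula set) = star_theorems CCC \<and>
      (star_theorems CCC :: 'a formula set) \<subseteq> cirq_theorems CCC \<and>
      (cirq_theorems CCC :: 'a formula set) = seq_theorems Classical_logic)"
proof -
  have 1: "seq_theorems Affine_logic = (star_theorems CL5 :: 'a formula set)"
    by (rule seq_theorems_eq_star_theorems) (auto simp: Affine_logic_def CL5_def)
  have 2: "seq_theorems Classical_logic = (star_theorems CCC :: 'a formula set)"
    by (rule seq_theorems_eq_star_theorems) (auto simp: Classical_logic_def CCC_def)
  fix p :: 'a
  have "blass p \<in> cirq_theorems CL5" "blass p \<notin> seq_theorems Affine_logic"
    unfolding cirq_theorems_iff seq_theorems_iff by (rule blass_cirq_derivable, rule blass_not_affine)
  then have 3: "(cirq_theorems CL5 :: 'a formula set) \<noteq> seq_theorems Affine_logic" by blast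
  show ?thesis
    using 1 2 3 star_theorems_subset_cirq_theorems[of CL5] star_theorems_subset_cirq_theorems[of CCC]
      cirq_theorems_subset_Classical[of CCC] by blast
qed

end
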